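(* Let $(k_j)_{j=0}^\infty$ be a strictly increasing sequence of nonnegative integers whose range $K=\{k_j : j\ge 0\}$ is a Hadamard set, and let $v=(v_j)_{j=0}^\infty\in\ell^2$ be a square-summable sequence of complex numbers. Then the matrix $A_v$ represents a bounded operator on $\ell^2$.
   Context: Here $\ell^2$ is the space of square-summable complex sequences indexed by the nonnegative integers. The set $K=\{k_j\}$ is called a Hadamard set if there is a constant $\varepsilon>0$ such that $k_{j+1}>(1+\varepsilon)k_j$ for all $j\ge 0$. Given $K$ and $v$, let $a_v$ be the function on the nonnegative integers with $a_v(k_j)=v_j$ for all $j$ and $a_v(n)=0$ when $n\notin K$. The matrix $A_v$ is the semi-infinite (Hankel) matrix with entries $A_v(m,n)=a_v(m+n)$ for integers $m,n\ge 0$. For a semi-infinite matrix $A=(A(m,n))_{m,n\ge0}$, put $$\|A\|_\infty=\sup\left\{\left|\sum_{m=0}^\infty\sum_{n=0}^\infty A(m,n)g(m)h(n)\right| : g,h\in F\right\},$$ where $F$ is the set of all finitely supported sequences in the unit ball of $\ell^2$. The matrix $A$ represents a bounded operator on $\ell^2$ exactly when $\|A\|_\infty<\infty$, and then $\|A\|_\infty$ is its operator norm. *)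

theory Defs
  imports "HOL-Analysis.Analysis"
begin

definition l2 :: "(nat \<Rightarrow> complex) set" where
  "l2 = {x. summable (\<lambda>n. (cmod (x n))\<^sup>2)}"

text \<open>Meaningful only for members of \<^const>\<open>l2\<close>.\<close>

definition l2_norm :: "(nat \<Rightarrow> complex) \<Rightarrow> real" where
  "l2_norm x = sqrt (\<Sum>n. (cmod (x n))\<^sup>2)"

text \<open>Operators on the sequence space are total functions on sequences; only their
  restriction to \<^const>\<open>l2\<close> matters. Linearity is over the complex numbers.\<close>

definition bounded_l2_operator :: "((nat \<Rightarrow> complex) \<Rightarrow> (nat \<Rightarrow> complex)) \<Rightarrow> bool" where
  "bounded_l2_operator T \<longleftrightarrow>
     (\<forall>x\<in>l2. T x \<in> l2) \<and>
     (\<forall>x\<in>l2. \<forall>y\<in>l2. T (\<lambda>n. x n + y n) = (\<lambda>n. T x n + T y n)) \<and>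
     (\<forall>c. \<forall>x\<in>l2. T (\<lambda>n. c * x n) = (\<lambda>n. c * T x n)) \<and>
     (\<exists>C. \<forall>x\<in>l2. l2_norm (T x) \<le> C * l2_norm x)"

text \<open>The operator acts by matrix multiplication; convergence of every row series is
  part of the requirement.\<close>

definition represents ::
    "(nat \<Rightarrow> nat \<Rightarrow> complex) \<Rightarrow> ((nat \<Rightarrow> complex) \<Rightarrow> (nat \<Rightarrow> complex)) \<Rightarrow> bool" where
  "represents A T \<longleftrightarrow> (\<forall>x\<in>l2. \<forall>m. (\<lambda>n. A m n * x n) sums T x m)"

definition represents_bounded_operator :: "(nat \<Rightarrow> nat \<Rightarrow> complex) \<Rightarrow> bool" where
  "represents_bounded_operator A \<longleftrightarrow> (\<exists>T. bounded_l2_operator T \<and> represents A T)"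

text \<open>The Hadamard condition on a set of nonnegative integers is a condition on its
  increasing enumeration, here \<open>k\<close>.\<close>

definition Hadamard :: "(nat \<Rightarrow> nat) \<Rightarrow> bool" where
  "Hadamard k \<longleftrightarrow> (\<exists>\<epsilon>::real. \<epsilon> > 0 \<and> (\<forall>j. real (k (Suc j)) > (1 + \<epsilon>) * real (k j)))"

text \<open>For injective \<open>k\<close> this is the function with value \<open>v j\<close> at \<open>k j\<close>,
  vanishing off the range of \<open>k\<close>.\<close>

definition lacunary_coeff :: "(nat \<Rightarrow> nat) \<Rightarrow> (nat \<Rightarrow> complex) \<Rightarrow> nat \<Rightarrow> complex" where
  "lacunary_coeff k v n = (if n \<in> range k then v (inv k n) else 0)"

definition hankel_matrix :: "(nat \<Rightarrow> nat) \<Rightarrow> (nat \<Rightarrow> complex) \<Rightarrow> nat \<Rightarrow> nat \<Rightarrow> complex" where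
  "hankel_matrix k v m n = lacunary_coeff k v (m + n)"

end

(* The entry a(m+n) is nonzero only if m + n lies in K, and lacunarity bounds, for every t, the
   number of elements of K in [t, 2t] by a constant N.  Split row m at n = m.  The part
   n \<le> m involves at most N nonzero terms since m + n lies in [m, 2m], so Cauchy-Schwarz on
   these terms and summation over m first give N |a|^2 |x|^2 (norms in l2).  On the part n > m
   Cauchy-Schwarz leaves |a|^2 times the sum of |x(n)|^2 over m + n in K; summing over m, every
   n occurs at most N times since m + n lies in [n, 2n]. *)
theory Submission
  imports Defs
begin

lemma Cauchy_Schwarz_suminf:
  fixes f g :: "nat \<Rightarrow> real"
  assumes f: "summable (\<lambda>n. (f n)\<^sup>2)" and g: "summable (\<lambda>n. (g n)\<^sup>2)"
  shows "summable (\<lambda>n. \<bar>f n * g n\<bar>)"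
    and "(\<Sum>n. f n * g n)\<^sup>2 \<le> (\<Sum>n. (f n)\<^sup>2) * (\<Sum>n. (g n)\<^sup>2)"
proof -
  have "norm \<bar>f n * g n\<bar> \<le> (f n)\<^sup>2 + (g n)\<^sup>2" for n
    using sum_squares_bound[of "\<bar>f n\<bar>" "\<bar>g n\<bar>"] abs_ge_zero[of "f n * g n"]
    unfolding real_norm_def abs_idempotent abs_mult power2_abs by linarith
  then show s: "summable (\<lambda>n. \<bar>f n * g n\<bar>)"
    by (rule summable_comparison_test'[OF summable_add[OF f g]])
  have "(\<lambda>M. (\<Sum>n<M. f n * g n)\<^sup>2) \<longlonglongrightarrow> (\<Sum>n. f n * g n)\<^sup>2"
    by (intro tendsto_power summable_LIMSEQ summable_rabs_cancel[OF s])
  moreover have "(\<Sum>n<M. f n * g n)\<^sup>2 \<le> (\<Sum>n. (f n)\<^sup>2) * (\<Sum>n. (g n)\<^sup>2)" for M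
    by (rule order_trans[OF Cauchy_Schwarz_ineq_sum])
      (intro mult_mono sum_le_suminf sum_nonneg suminf_nonneg f g; simp)
  ultimately show "(\<Sum>n. f n * g n)\<^sup>2 \<le> (\<Sum>n. (f n)\<^sup>2) * (\<Sum>n. (g n)\<^sup>2)"
    by (intro LIMSEQ_le_const2) auto
qed

text \<open>Iterating the gap condition \<open>p\<close> times multiplies a value of
  \<open>k\<close> by at least \<open>(1 + \<epsilon>) ^ p\<close>, which exceeds 2 for a suitable
  \<open>p\<close>. Hence the first element of the range at or above a positive \<open>n\<close> and
  its \<open>p - 1\<close> successors exhaust the range within \<open>{n..2 * n}\<close>, and
  \<open>N = p\<close> works.\<close>

lemma Hadamard_dyadic_card_le:
  assumes "strict_mono k" and "Hadamard k"
  obtains N where "\<And>n. card (range k \<inter> {n..2 * n}) \<le> N"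
proof -
  obtain \<epsilon> :: real where \<epsilon>: "\<epsilon> > 0" "\<And>j. real (k (Suc j)) > (1 + \<epsilon>) * real (k j)"
    using assms(2) unfolding Hadamard_def by blast
  obtain p where p: "2 < (1 + \<epsilon>) ^ p"
    using real_arch_pow[of "1 + \<epsilon>" 2] \<epsilon>(1) by auto
  have "p > 0"
    using p by (cases p) auto
  have growth: "(1 + \<epsilon>) ^ q * real (k j) \<le> real (k (j + q))" for q j
  proof (induction q)
    case (Suc q)
    have "(1 + \<epsilon>) * ((1 + \<epsilon>) ^ q * real (k j)) \<le> (1 + \<epsilon>) * real (k (j + q))"
      using Suc \<epsilon>(1) by (intro mult_left_mono) auto
    with \<epsilon>(2)[of "j + q"] show ?case by (simp add: mult.assoc)
  qed auto
  have "card (range k \<inter> {n..2 * n}) \<le> p" for n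
  \<comment> \<open>The doubling argument needs the strict inequality
    \<open>2 * n < (1 + \<epsilon>) ^ p * n\<close>, which fails at 0. There the interval is a
    single point, and \<open>p > 0\<close> suffices.\<close>
  proof (cases "n = 0")
    case True
    then have "range k \<inter> {n..2 * n} \<subseteq> {0}" by auto
    then have "card (range k \<inter> {n..2 * n}) \<le> 1"
      using card_mono[of "{0::nat}"] by simp
    with \<open>p > 0\<close> show ?thesis by simp
  next
    case False
    define j0 where "j0 = (LEAST j. n \<le> k j)"
    have j0: "n \<le> k j0"
      \<comment> \<open>The least index exists because a strictly increasing \<open>k\<close>
        satisfies \<open>n \<le> k n\<close>.\<close>
      unfolding j0_def by (rule LeastI[of _ n]) (rule strict_mono_imp_increasing[OF assms(1)])
    have "range k \<inter> {n..2 * n} \<subseteq> k ` {j0..<j0 + p}"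
    proof
      fix l assume "l \<in> range k \<inter> {n..2 * n}"
      then obtain j where j: "l = k j" "n \<le> k j" "k j \<le> 2 * n" by auto
      have "j0 \<le> j"
        unfolding j0_def by (rule Least_le) (rule j(2))
      moreover have "j < j0 + p"
      proof (rule ccontr)
        assume "\<not> j < j0 + p"
        then have "k (j0 + p) \<le> k j"
          using strict_mono_less_eq[OF assms(1)] by simp
        moreover have "2 * real n < (1 + \<epsilon>) ^ p * real n"
          using p False by simp
        moreover have "(1 + \<epsilon>) ^ p * real n \<le> (1 + \<epsilon>) ^ p * real (k j0)"
          using j0 \<epsilon>(1) by (intro mult_left_mono) auto
        ultimately show False
          using growth[of p j0] j(3) by linarith
      qed
      ultimately show "l \<in> k ` {j0..<j0 + p}"
        using j(1) by auto
    qed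
    then have "card (range k \<inter> {n..2 * n}) \<le> card (k ` {j0..<j0 + p})"
      by (intro card_mono) auto
    also have "\<dots> \<le> p"
      using card_image_le[of "{j0..<j0 + p}" k] by simp
    finally show ?thesis .
  qed
  then show thesis by (rule that)
qed

text \<open>The entries of \<open>v\<close> are only moved to the positions \<open>k j\<close>, with
  zeros in between, so the series of squares is reindexed without changing its summability.\<close>

lemma lacunary_coeff_in_l2:
  assumes "strict_mono k" and "v \<in> l2"
  shows "lacunary_coeff k v \<in> l2"
proof -
  have "lacunary_coeff k v (k j) = v j" for j
    using strict_mono_imp_inj_on[OF assms(1)] by (simp add: lacunary_coeff_def)
  moreover have "lacunary_coeff k v n = 0" if "n \<notin> range k" for n
    using that by (simp add: lacunary_coeff_def)
  ultimately show ?thesis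
    using assms summable_mono_reindex[of k "\<lambda>n. (cmod (lacunary_coeff k v n))\<^sup>2"]
    by (simp add: l2_def)
qed

text \<open>The two parts of a row contribute \<open>N\<close> times the product of the squared
  norms each, and separating them costs a factor 2, whence the 4. Only finitely many rows are
  summed, so no convergence over \<open>m\<close> is presupposed; the bound does not depend on
  \<open>M\<close>.\<close>

lemma dyadic_sparse_hankel_sum_le:
  fixes a y :: "nat \<Rightarrow> real"
  assumes card: "\<And>n. card (K \<inter> {n..2 * n}) \<le> N"
    and supp: "\<And>n. n \<notin> K \<Longrightarrow> a n = 0"
    and a: "summable (\<lambda>n. (a n)\<^sup>2)" and y: "summable (\<lambda>n. (y n)\<^sup>2)"
  shows "(\<Sum>m<M. (\<Sum>n. a (m + n) * y n)\<^sup>2)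
    \<le> 4 * real N * (\<Sum>n. (a n)\<^sup>2) * (\<Sum>n. (y n)\<^sup>2)"
proof -
  let ?A = "\<Sum>n. (a n)\<^sup>2" and ?Y = "\<Sum>n. (y n)\<^sup>2"
  \<comment> \<open>Masking \<open>y\<close> outside \<open>K\<close> does not change the products
    with \<open>a (m + n)\<close>, which vanish there. It does shrink the factor from
    \<open>y\<close> that Cauchy-Schwarz produces in \<open>Q\<close>.\<close>
  define z where "z m n = (if m < n \<and> m + n \<in> K then y n else 0)" for m n
  define P where "P m = (\<Sum>n\<le>m. a (m + n) * y n)" for m
  define Q where "Q m = (\<Sum>n. a (m + n) * z m n)" for m
  \<comment> \<open>This count serves twice: for the columns in a row of \<open>P\<close> and, by
    the symmetry of \<open>m + n\<close>, for the rows meeting a column of \<open>Q\<close>.\<close>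
  have card': "card {n. n \<le> m \<and> m + n \<in> K} \<le> N" for m
  proof -
    have "card {n. n \<le> m \<and> m + n \<in> K} \<le> card (K \<inter> {m..2 * m})"
      by (rule card_inj_on_le[where f = "\<lambda>n. m + n"]) (auto simp: inj_on_def)
    with card show ?thesis by (rule le_trans[rotated])
  qed
  have a': "summable (\<lambda>n. (a (m + n))\<^sup>2)" for m
    using summable_ignore_initial_segment[OF a, of m] by (simp add: add.commute)
  have tail_le: "(\<Sum>n. (a (m + n))\<^sup>2) \<le> ?A" for m
    using suminf_split_initial_segment[OF a, of m] sum_nonneg[of "{..<m}" "\<lambda>n. (a n)\<^sup>2"]
    by (simp add: add.commute)
  have z: "summable (\<lambda>n. (z m n)\<^sup>2)" for m
    by (rule summable_comparison_test'[OF y]) (auto simp: z_def)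
  have split: "(\<Sum>n. a (m + n) * y n) = P m + Q m" for m
  proof -
    have "(\<lambda>n. (if n \<in> {..m} then a (m + n) * y n else 0)) sums P m"
      unfolding P_def by (rule sums_If_finite_set) simp
    moreover have "(\<lambda>n. a (m + n) * z m n) sums Q m"
      unfolding Q_def
      by (intro summable_sums summable_rabs_cancel[OF Cauchy_Schwarz_suminf(1)] a' z)
    ultimately have "(\<lambda>n. (if n \<in> {..m} then a (m + n) * y n else 0) + a (m + n) * z m n)
        sums (P m + Q m)"
      by (rule sums_add)
    also have "(\<lambda>n. (if n \<in> {..m} then a (m + n) * y n else 0) + a (m + n) * z m n)
        = (\<lambda>n. a (m + n) * y n)"
      by (auto simp: fun_eq_iff z_def supp)
    finally show ?thesis by (rule sums_unique[symmetric])
  qed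
  have P: "(P m)\<^sup>2 \<le> real N * (\<Sum>n\<le>m. (a (m + n))\<^sup>2 * (y n)\<^sup>2)" for m
  proof -
    let ?S = "{n. n \<le> m \<and> m + n \<in> K}"
    \<comment> \<open>Restricting to the nonzero terms first makes the Cauchy-Schwarz factor the
      number of these terms instead of \<open>m + 1\<close>.\<close>
    have "P m = (\<Sum>n\<in>?S. a (m + n) * y n)"
      unfolding P_def by (rule sum.mono_neutral_right) (auto simp: supp)
    then have "(P m)\<^sup>2 \<le> (\<Sum>n\<in>?S. (a (m + n) * y n)\<^sup>2) * real (card ?S)"
      using sum_squared_le_sum_of_squares[of "\<lambda>n. a (m + n) * y n" ?S] by simp
    also have "\<dots> \<le> (\<Sum>n\<le>m. (a (m + n) * y n)\<^sup>2) * real N"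
      using card' by (intro mult_mono sum_mono2 sum_nonneg) auto
    finally show ?thesis by (simp add: power_mult_distrib mult.commute)
  qed
  have sumP: "(\<Sum>m<M. (P m)\<^sup>2) \<le> real N * (?A * ?Y)"
  proof -
    have "(\<Sum>m<M. (P m)\<^sup>2) \<le> real N * (\<Sum>m<M. \<Sum>n\<le>m. (a (m + n))\<^sup>2 * (y n)\<^sup>2)"
      unfolding sum_distrib_left by (rule sum_mono) (use P in \<open>simp add: sum_distrib_left\<close>)
    \<comment> \<open>Filling the triangle up to a square lets the sums be exchanged; for fixed
      \<open>n\<close> the sum over \<open>m\<close> is then part of a tail of the series
      \<open>?A\<close>.\<close>
    also have "(\<Sum>m<M. \<Sum>n\<le>m. (a (m + n))\<^sup>2 * (y n)\<^sup>2)
        \<le> (\<Sum>m<M. \<Sum>n<M. (a (m + n))\<^sup>2 * (y n)\<^sup>2)"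
      by (intro sum_mono sum_mono2) auto
    also have "\<dots> = (\<Sum>n<M. (\<Sum>m<M. (a (n + m))\<^sup>2) * (y n)\<^sup>2)"
      by (subst sum.swap) (simp add: sum_distrib_right add.commute)
    also have "\<dots> \<le> (\<Sum>n<M. ?A * (y n)\<^sup>2)"
      by (intro sum_mono mult_right_mono order_trans[OF sum_le_suminf[OF a'] tail_le]) auto
    also have "\<dots> = ?A * (\<Sum>n<M. (y n)\<^sup>2)"
      by (simp add: sum_distrib_left)
    also have "\<dots> \<le> ?A * ?Y"
      by (intro mult_left_mono sum_le_suminf y suminf_nonneg a) auto
    finally show ?thesis by (simp add: mult_left_mono)
  qed
  have sumQ: "(\<Sum>m<M. (Q m)\<^sup>2) \<le> ?A * (real N * ?Y)"
  proof -
    have "(\<Sum>m<M. (Q m)\<^sup>2) \<le> (\<Sum>m<M. ?A * (\<Sum>n. (z m n)\<^sup>2))"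
      unfolding Q_def
      by (intro sum_mono order_trans[OF Cauchy_Schwarz_suminf(2)] mult_right_mono tail_le
          suminf_nonneg a' z) auto
    also have "\<dots> = ?A * (\<Sum>n. \<Sum>m<M. (z m n)\<^sup>2)"
      by (simp add: suminf_sum[OF z] sum_distrib_left)
    also have "\<dots> \<le> ?A * (\<Sum>n. real N * (y n)\<^sup>2)"
    proof (intro mult_left_mono suminf_le summable_sum summable_mult z y suminf_nonneg a)
      fix n
      let ?S = "{m. m < M \<and> m < n \<and> m + n \<in> K}"
      have "(\<Sum>m<M. (z m n)\<^sup>2) = (\<Sum>m\<in>?S. (y n)\<^sup>2)"
        by (rule sum.mono_neutral_cong_right) (auto simp: z_def)
      also have "\<dots> \<le> real N * (y n)\<^sup>2"
      proof -
        have "card ?S \<le> card {m. m \<le> n \<and> n + m \<in> K}"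
          by (rule card_mono) (auto simp: add.commute)
        with card'[of n] show ?thesis
          by (simp add: mult_right_mono)
      qed
      finally show "(\<Sum>m<M. (z m n)\<^sup>2) \<le> real N * (y n)\<^sup>2" .
    qed auto
    finally show ?thesis by (simp add: suminf_mult[OF y])
  qed
  have "(\<Sum>m<M. (\<Sum>n. a (m + n) * y n)\<^sup>2) \<le> (\<Sum>m<M. 2 * (P m)\<^sup>2 + 2 * (Q m)\<^sup>2)"
  proof (rule sum_mono)
    fix m
    show "(\<Sum>n. a (m + n) * y n)\<^sup>2 \<le> 2 * (P m)\<^sup>2 + 2 * (Q m)\<^sup>2"
      \<comment> \<open>The cross term is absorbed by
        \<open>2 * P m * Q m \<le> (P m)\<^sup>2 + (Q m)\<^sup>2\<close>.\<close>
      unfolding split power2_sum using sum_squares_bound[of "P m" "Q m"] by linarith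
  qed
  also have "\<dots> = 2 * (\<Sum>m<M. (P m)\<^sup>2) + 2 * (\<Sum>m<M. (Q m)\<^sup>2)"
    by (simp add: sum.distrib sum_distrib_left)
  also have "\<dots> \<le> 2 * (real N * (?A * ?Y)) + 2 * (?A * (real N * ?Y))"
    using sumP sumQ by linarith
  finally show ?thesis by (simp add: mult_ac)
qed

text \<open>Taking moduli reduces the bound to the real estimate. Rows converge absolutely by
  Cauchy-Schwarz, which makes the row sums a linear operator on \<open>l2\<close>; the uniform bound
  on partial sums gives both membership in \<open>l2\<close> and the norm inequality.\<close>

lemma dyadic_sparse_hankel_bounded:
  fixes a :: "nat \<Rightarrow> complex"
  assumes card: "\<And>n. card (K \<inter> {n..2 * n}) \<le> N"
    and supp: "\<And>n. n \<notin> K \<Longrightarrow> a n = 0"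
    and a: "a \<in> l2"
  shows "represents_bounded_operator (\<lambda>m n. a (m + n))"
proof -
  define T where "T x m = (\<Sum>n. a (m + n) * x n)" for x m
  define C where "C = sqrt (4 * real N * (\<Sum>n. (cmod (a n))\<^sup>2))"
  have a2: "summable (\<lambda>n. (cmod (a n))\<^sup>2)"
    using a by (simp add: l2_def)
  have norm_summable: "summable (\<lambda>n. cmod (a (m + n) * x n))" if "x \<in> l2" for x m
  proof -
    have "summable (\<lambda>n. (cmod (a (m + n)))\<^sup>2)"
      using summable_ignore_initial_segment[OF a2, of m] by (simp add: add.commute)
    from Cauchy_Schwarz_suminf(1)[OF this, of "\<lambda>n. cmod (x n)"] that show ?thesis
      by (simp add: l2_def norm_mult)
  qed
  have row: "summable (\<lambda>n. a (m + n) * x n)" if "x \<in> l2" for x m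
    by (rule summable_norm_cancel) (rule norm_summable[OF that])
  have partial: "(\<Sum>m<M. (cmod (T x m))\<^sup>2) \<le> C\<^sup>2 * (\<Sum>n. (cmod (x n))\<^sup>2)" if x: "x \<in> l2" for x M
  proof -
    have "(\<Sum>m<M. (cmod (T x m))\<^sup>2) \<le> (\<Sum>m<M. (\<Sum>n. cmod (a (m + n)) * cmod (x n))\<^sup>2)"
      unfolding T_def norm_mult[symmetric]
      by (intro sum_mono power_mono summable_norm norm_summable x norm_ge_zero)
    also have "\<dots> \<le> 4 * real N * (\<Sum>n. (cmod (a n))\<^sup>2) * (\<Sum>n. (cmod (x n))\<^sup>2)"
      by (rule dyadic_sparse_hankel_sum_le[OF card]) (use supp a2 x in \<open>auto simp: l2_def\<close>)
    finally show ?thesis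
      by (simp add: C_def suminf_nonneg[OF a2])
  qed
  have Tx: "T x \<in> l2" if "x \<in> l2" for x
    \<comment> \<open>The summability criterion bounds sums over \<open>{..n}\<close>, so the
      estimate is used with \<open>M\<close> equal to a successor.\<close>
    using bounded_imp_summable[OF _ partial[OF that, of "Suc _", unfolded lessThan_Suc_atMost]]
    by (simp add: l2_def)
  have "l2_norm (T x) \<le> C * l2_norm x" if x: "x \<in> l2" for x
  proof -
    have "(\<Sum>m. (cmod (T x m))\<^sup>2) \<le> C\<^sup>2 * (\<Sum>n. (cmod (x n))\<^sup>2)"
      using Tx[OF x] partial[OF x] by (intro suminf_le_const) (auto simp: l2_def)
    then have "l2_norm (T x) \<le> sqrt (C\<^sup>2 * (\<Sum>n. (cmod (x n))\<^sup>2))"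
      unfolding l2_norm_def by (rule real_sqrt_le_mono)
    also have "\<dots> = C * l2_norm x"
      by (simp add: real_sqrt_mult l2_norm_def C_def suminf_nonneg[OF a2])
    finally show ?thesis .
  qed
  moreover have "T (\<lambda>n. x n + y n) = (\<lambda>n. T x n + T y n)" if "x \<in> l2" "y \<in> l2" for x y
    by (simp add: T_def distrib_left suminf_add row that fun_eq_iff)
  moreover have "T (\<lambda>n. c * x n) = (\<lambda>n. c * T x n)" if "x \<in> l2" for c x
    by (simp add: T_def mult.left_commute[of _ c] suminf_mult row that fun_eq_iff)
  ultimately have "bounded_l2_operator T"
    unfolding bounded_l2_operator_def using Tx by blast
  moreover have "represents (\<lambda>m n. a (m + n)) T"
    unfolding represents_def T_def using row summable_sums by blast
  ultimately show ?thesis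
    unfolding represents_bounded_operator_def by blast
qed

theorem theorem1p1:
  fixes k :: "nat \<Rightarrow> nat" and v :: "nat \<Rightarrow> complex"
  assumes "strict_mono k"
    and "Hadamard k"
    and "v \<in> l2"
  shows "represents_bounded_operator (hankel_matrix k v)"
proof -
  obtain N where "\<And>n. card (range k \<inter> {n..2 * n}) \<le> N"
    using Hadamard_dyadic_card_le[OF assms(1,2)] by blast
  then have "represents_bounded_operator (\<lambda>m n. lacunary_coeff k v (m + n))"
    by (rule dyadic_sparse_hankel_bounded[OF _ _ lacunary_coeff_in_l2[OF assms(1,3)]])
      (simp add: lacunary_coeff_def)
  then show ?thesis
    by (simp add: hankel_matrix_def[abs_def])
qed

end
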